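(* For the Santa Claus problem on two uniformly related machines with speed ratio $s\ge 1$, the online bounded ratio of the algorithm $G$ is $\frac1s$.
   Context: There are two machines with speeds $1$ and $s$. Jobs with positive sizes arrive online and each must be assigned irrevocably to one machine; the completion time (load) of a machine is the total size of its jobs divided by its speed; the goal is to maximize the minimum completion time over the two machines. The algorithm $G$ assigns each job to a machine with the currently smallest completion time. For a deterministic online algorithm $A$ of a maximization problem, $\textsc{Opt}_A$ denotes an offline algorithm that is optimal among offline algorithms whose solution on any input $I$ satisfies, for every prefix $I'$ of $I$, that the value of the solution restricted to $I'$ is at least $A(I')$. The online bounded ratio of $A$ is the supremum of all constants $c$ such that $A(I) \ge c\,\textsc{Opt}_A(I)$ for all inputs $I$. *)

theory Defs
  imports Complex_Main "HOL-Library.Extended_Real"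
begin

datatype machine = M1 | M2

definition speed :: "real \<Rightarrow> machine \<Rightarrow> real" where
  "speed s m = (case m of M1 \<Rightarrow> 1 | M2 \<Rightarrow> s)"

text \<open>An input is the list of job sizes in order of arrival.\<close>

definition valid_input :: "real list \<Rightarrow> bool" where
  "valid_input I \<longleftrightarrow> (\<forall>p\<in>set I. 0 < p)"

text \<open>A solution for \<open>I\<close> is a list \<open>S\<close> with \<open>length S = length I\<close>; job \<open>I ! i\<close> is assigned to
  machine \<open>S ! i\<close>.\<close>

definition completion_time :: "real \<Rightarrow> real list \<Rightarrow> machine list \<Rightarrow> machine \<Rightarrow> real" where
  "completion_time s I S m = (\<Sum>i | i < length I \<and> S ! i = m. I ! i) / speed s m"

definition solution_value :: "real \<Rightarrow> real list \<Rightarrow> machine list \<Rightarrow> real" where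
  "solution_value s I S = min (completion_time s I S M1) (completion_time s I S M2)"

text \<open>A deterministic online algorithm maps the sizes of the earlier jobs and the size of the
  arriving job to the machine receiving it. Its own earlier assignments are determined by the
  earlier jobs, so they need not be passed as an argument.\<close>

type_synonym online_algorithm = "real list \<Rightarrow> real \<Rightarrow> machine"

definition run :: "online_algorithm \<Rightarrow> real list \<Rightarrow> machine list" where
  "run A I = map (\<lambda>i. A (take i I) (I ! i)) [0..<length I]"

text \<open>Ties may be broken in any way, possibly depending on the whole history.\<close>

definition greedy :: "real \<Rightarrow> online_algorithm \<Rightarrow> bool" where
  "greedy s A \<longleftrightarrow>
     (\<forall>I p. valid_input I \<and> 0 < p \<longrightarrow>
        (\<forall>m. completion_time s I (run A I) (A I p) \<le> completion_time s I (run A I) m))"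

type_synonym offline_algorithm = "real list \<Rightarrow> machine list"

definition online_bounded :: "real \<Rightarrow> online_algorithm \<Rightarrow> offline_algorithm \<Rightarrow> bool" where
  "online_bounded s A B \<longleftrightarrow>
     (\<forall>I. valid_input I \<longrightarrow>
        length (B I) = length I \<and>
        (\<forall>n\<le>length I. solution_value s (take n I) (run A (take n I))
                        \<le> solution_value s (take n I) (take n (B I))))"

definition is_Opt :: "real \<Rightarrow> online_algorithm \<Rightarrow> offline_algorithm \<Rightarrow> bool" where
  "is_Opt s A B \<longleftrightarrow>
     online_bounded s A B \<and>
     (\<forall>B'. online_bounded s A B' \<longrightarrow>
        (\<forall>I. valid_input I \<longrightarrow> solution_value s I (B' I) \<le> solution_value s I (B I)))"

text \<open>Such an algorithm always exists, see \<open>is_Opt_Opt\<close> below.\<close>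

definition Opt :: "real \<Rightarrow> online_algorithm \<Rightarrow> offline_algorithm" where
  "Opt s A = (SOME B. is_Opt s A B)"

text \<open>The supremum is taken in the extended reals, so that it is meaningful whether or not the
  set of constants is nonempty and bounded.\<close>

definition online_bounded_ratio :: "real \<Rightarrow> online_algorithm \<Rightarrow> ereal" where
  "online_bounded_ratio s A =
     Sup {ereal c | c. \<forall>I. valid_input I \<longrightarrow>
                         c * solution_value s I (Opt s A I) \<le> solution_value s I (run A I)}"

lemma length_run [simp]: "length (run A I) = length I"
  by (simp add: run_def)

lemma take_run: "take n (run A I) = run A (take n I)"
proof (rule nth_equalityI)
  show "length (take n (run A I)) = length (run A (take n I))"
    by simp
  fix i assume "i < length (take n (run A I))"
  then have "i < n" "i < length I" by auto
  then show "take n (run A I) ! i = run A (take n I) ! i"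
    by (simp add: run_def)
qed

lemma is_Opt_Opt: "is_Opt s A (Opt s A)"
proof -
  define F where "F I = {S. length S = length I \<and>
      (\<forall>n\<le>length I. solution_value s (take n I) (run A (take n I))
                        \<le> solution_value s (take n I) (take n S))}" for I
  have UNIV_machine: "(UNIV :: machine set) = {M1, M2}"
    using machine.exhaust by auto
  have "finite {S :: machine list. set S \<subseteq> UNIV \<and> length S = length I}" for I :: "real list"
    by (rule finite_lists_length_eq) (simp add: UNIV_machine)
  then have fin: "finite (F I)" for I
    by (rule finite_subset[rotated]) (auto simp: F_def)
  have ne: "run A I \<in> F I" for I
    by (simp add: F_def take_run)
  have "\<exists>S\<in>F I. \<forall>S'\<in>F I. solution_value s I S' \<le> solution_value s I S" for I
  proof -
    have "Max (solution_value s I ` F I) \<in> solution_value s I ` F I"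
      using fin[of I] ne[of I] by (intro Max_in) auto
    then obtain S where "S \<in> F I" "Max (solution_value s I ` F I) = solution_value s I S"
      by blast
    then show ?thesis
      using fin[of I] by (metis Max_ge finite_imageI imageI)
  qed
  then obtain B where B: "B I \<in> F I" "\<forall>S'\<in>F I. solution_value s I S' \<le> solution_value s I (B I)" for I
    by metis
  have ob: "online_bounded s A B' \<longleftrightarrow> (\<forall>I. valid_input I \<longrightarrow> B' I \<in> F I)" for B'
    by (simp add: online_bounded_def F_def)
  have "is_Opt s A B"
    unfolding is_Opt_def ob using B by blast
  then show ?thesis
    unfolding Opt_def by (rule someI[where P = "is_Opt s A"])
qed

text \<open>The predicate \<open>greedy s\<close> is satisfiable: break ties in favour of \<open>M1\<close>.\<close>

definition less_loaded :: "real \<Rightarrow> real list \<Rightarrow> machine list \<Rightarrow> machine" where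
  "less_loaded s I S =
     (if completion_time s I S M1 \<le> completion_time s I S M2 then M1 else M2)"

primrec greedy_schedule_rev :: "real \<Rightarrow> real list \<Rightarrow> machine list" where
  "greedy_schedule_rev s [] = []"
| "greedy_schedule_rev s (p # J) =
     greedy_schedule_rev s J @ [less_loaded s (rev J) (greedy_schedule_rev s J)]"

lemma run_snoc: "run A (I @ [p]) = run A I @ [A I p]"
  by (simp add: run_def nth_append)

lemma greedy_exists: "\<exists>A. greedy s A"
proof -
  define A :: online_algorithm
    where "A I p = less_loaded s I (greedy_schedule_rev s (rev I))" for I p
  have run: "run A I = greedy_schedule_rev s (rev I)" for I
  proof (induction I rule: rev_induct)
    case Nil
    show ?case by (simp add: run_def)
  next
    case (snoc p I)
    then show ?case by (simp add: run_snoc A_def)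
  qed
  have "completion_time s I (run A I) (A I p) \<le> completion_time s I (run A I) m" for I p m
    unfolding run A_def less_loaded_def by (cases m) auto
  then have "greedy s A"
    by (simp add: greedy_def)
  then show ?thesis
    by (rule exI[where P = "greedy s"])
qed

end

(* Let g1, g2 be the total job sizes on the two machines in the schedule of the greedy algorithm, and
   o1, o2 those of an online bounded solution, so that g1 + g2 = o1 + o2.  By induction on the input,

     (o1 <= g2 or o2 <= g2)  and  (o1 <= g1 or o2 <= s * g1),

   which yields min o1 (o2/s) <= s * min g1 (g2/s).  When greedy puts a job on the first machine,
   g1 <= g2/s was its value, so o1 >= g1 and o2 >= s * g1 held before the job.  Hence o2 <= g2, and
   o1 <= g1 + g2 - s * g1 <= g2; whichever machine receives the job in the other solution, one of the
   two bounds survives.  The second disjunction is restored in the same way when greedy uses the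
   second machine, and each disjunction is trivially preserved in the remaining case.

   For tightness, let a job of size 1 arrive first, and then a job of size 1/s or s, depending on
   whether greedy used the first or the second machine.  Swapping the two machines is online bounded,
   since both values are 0 until the second job, and multiplies the value by s. *)

theory Submission
  imports Defs
begin

section \<open>Machine loads and prefix-wise bounded schedules\<close>

definition load :: "real list \<Rightarrow> machine list \<Rightarrow> machine \<Rightarrow> real" where
  "load I S m = (\<Sum>i | i < length I \<and> S ! i = m. I ! i)"

lemma load_Nil [simp]: "load [] S m = 0"
  by (simp add: load_def)

lemma load_snoc:
  assumes "length S = length I"
  shows "load (I @ [p]) (S @ [m']) m = load I S m + (if m' = m then p else 0)"
proof -
  let ?A = "{i. i < length I \<and> S ! i = m}"
  have "{i. i < length (I @ [p]) \<and> (S @ [m']) ! i = m} =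
      ?A \<union> (if m' = m then {length I} else {})"
    using assms by (auto simp: nth_append less_Suc_eq)
  moreover have "(\<Sum>i\<in>?A. (I @ [p]) ! i) = (\<Sum>i\<in>?A. I ! i)"
    by (intro sum.cong) (auto simp: nth_append)
  ultimately show ?thesis
    by (simp add: load_def)
qed

lemma completion_time_load:
  "completion_time s I S M1 = load I S M1" "completion_time s I S M2 = load I S M2 / s"
  by (simp_all add: completion_time_def load_def speed_def)

lemma solution_value_load: "solution_value s I S = min (load I S M1) (load I S M2 / s)"
  by (simp add: solution_value_def completion_time_load)

lemma load_nonneg:
  assumes "valid_input I"
  shows "0 \<le> load I S m"
  unfolding load_def using assms by (intro sum_nonneg) (auto simp: valid_input_def less_imp_le)

text \<open>Since loads are not divided by speeds, their total is the same for every schedule of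
  \<open>I\<close>; a lower bound on one machine thus becomes an upper bound on the other.\<close>

lemma load_M1_plus_M2:
  assumes "length S = length I"
  shows "load I S M1 + load I S M2 = sum_list I"
  using assms
proof (induction I arbitrary: S rule: rev_induct)
  case Nil
  show ?case by simp
next
  case (snoc p I)
  then obtain S' m where "S = S' @ [m]" "length S' = length I"
    by (cases S rule: rev_cases) auto
  with snoc.IH[of S'] show ?case
    by (cases m) (simp_all add: load_snoc)
qed

text \<open>Isolates the requirement of \<open>online_bounded\<close> for a single input and
  schedule, which permits induction on the last job.\<close>

definition dominates_prefixes :: "real \<Rightarrow> online_algorithm \<Rightarrow> real list \<Rightarrow> machine list \<Rightarrow> bool" where
  "dominates_prefixes s A I S \<longleftrightarrow>
     length S = length I \<and>
     (\<forall>n\<le>length I. solution_value s (take n I) (run A (take n I))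
                     \<le> solution_value s (take n I) (take n S))"

lemma online_bounded_iff:
  "online_bounded s A B \<longleftrightarrow> (\<forall>I. valid_input I \<longrightarrow> dominates_prefixes s A I (B I))"
  by (simp add: online_bounded_def dominates_prefixes_def)

lemma dominates_prefixes_snoc:
  "dominates_prefixes s A (I @ [p]) (S @ [m]) \<longleftrightarrow>
     dominates_prefixes s A I S \<and>
     solution_value s (I @ [p]) (run A (I @ [p])) \<le> solution_value s (I @ [p]) (S @ [m])"
  by (auto simp: dominates_prefixes_def le_Suc_eq)

lemma dominates_prefixes_value:
  assumes "dominates_prefixes s A I S"
  shows "solution_value s I (run A I) \<le> solution_value s I S"
  using assms by (auto simp: dominates_prefixes_def dest: spec[of _ "length I"])

lemma dominates_prefixes_run: "dominates_prefixes s A I (run A I)"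
  by (simp add: dominates_prefixes_def take_run)

section \<open>Greedy against online bounded schedules\<close>

lemma greedy_invariant:
  assumes s: "s \<ge> 1" and G: "greedy s G"
    and "valid_input I" "dominates_prefixes s G I S"
  shows "(load I S M1 \<le> load I (run G I) M2 \<or> load I S M2 \<le> load I (run G I) M2) \<and>
         (load I S M1 \<le> load I (run G I) M1 \<or> load I S M2 \<le> s * load I (run G I) M1)"
  using assms(3,4)
proof (induction I arbitrary: S rule: rev_induct)
  case Nil
  show ?case by simp
next
  case (snoc p I)
  from snoc.prems(2) obtain S' m where S: "S = S' @ [m]" "length S' = length I"
    by (cases S rule: rev_cases) (auto simp: dominates_prefixes_def)
  have dom: "dominates_prefixes s G I S'"
    using snoc.prems(2) by (simp add: S dominates_prefixes_snoc)
  have I: "valid_input I" and p: "p > 0"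
    using snoc.prems(1) by (auto simp: valid_input_def)
  define g1 g2 o1 o2 where "g1 = load I (run G I) M1" and "g2 = load I (run G I) M2"
    and "o1 = load I S' M1" and "o2 = load I S' M2"
  note defs = g1_def g2_def o1_def o2_def
  have total: "g1 + g2 = o1 + o2"
    by (simp add: defs load_M1_plus_M2 S(2))
  have ge: "min g1 (g2 / s) \<le> o1" "min g1 (g2 / s) \<le> o2 / s"
    using dominates_prefixes_value[OF dom] by (simp_all add: solution_value_load defs)
  have IH: "o1 \<le> g2 \<or> o2 \<le> g2" "o1 \<le> g1 \<or> o2 \<le> s * g1"
    using snoc.IH[OF I dom] by (simp_all add: defs)
  have least: "completion_time s I (run G I) (G I p) \<le> completion_time s I (run G I) m'" for m'
    using G I p by (simp add: greedy_def)
  \<comment> \<open>Here \<open>q\<close> stands for \<open>s * p\<close>; hiding the product keeps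
    the remaining goals linear.\<close>
  obtain q where q: "s * (g1 + p) = s * g1 + q" "p \<le> q"
    using s p by (simp add: distrib_left)
  show ?case
  proof (cases "G I p")
    case M1
    have "g1 \<le> g2 / s"
      using least[of M2] by (simp add: M1 completion_time_load defs)
    with ge have o: "g1 \<le> o1" "g1 \<le> o2 / s"
      using s by auto
    have g1: "0 \<le> g1"
      using I by (simp add: g1_def load_nonneg)
    have "s * g1 \<le> o2"
      using o(2) s by (simp add: field_simps)
    moreover have "g1 \<le> s * g1"
      using s g1 by (simp add: mult_le_cancel_right1)
    ultimately have "o1 \<le> g2" "o2 \<le> g2"
      using total o by linarith+
    then show ?thesis
      using IH(2) q p
      by (cases m) (auto simp: S M1 run_snoc load_snoc simp flip: defs)
  next
    case M2
    have le: "g2 / s \<le> g1"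
      using least[of M1] by (simp add: M2 completion_time_load defs)
    with ge have o: "g2 / s \<le> o1" "g2 \<le> o2"
      using s by (auto simp: divide_le_cancel)
    \<comment> \<open>Needed for \<open>o2\<close>: the total and \<open>g2 / s \<le> o1\<close>
      give \<open>o2 \<le> g1 + g2 - g2 / s\<close>, which must not exceed
      \<open>s * g1\<close>.\<close>
    have "(g1 - g2 / s) * 1 \<le> (g1 - g2 / s) * s"
      using le s by (intro mult_left_mono) auto
    also have "\<dots> = s * g1 - g2"
      using s by (simp add: field_simps)
    finally have "g1 - g2 / s \<le> s * g1 - g2"
      by simp
    then have "o1 \<le> g1" "o2 \<le> s * g1"
      using total o by linarith+
    then show ?thesis
      using IH(1) p
      by (cases m) (auto simp: S M2 run_snoc load_snoc simp flip: defs)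
  qed
qed

lemma greedy_lower_bound:
  assumes s: "s \<ge> 1" and G: "greedy s G"
    and I: "valid_input I" and dom: "dominates_prefixes s G I S"
  shows "solution_value s I S \<le> s * solution_value s I (run G I)"
proof -
  define g1 g2 o1 o2 where "g1 = load I (run G I) M1" and "g2 = load I (run G I) M2"
    and "o1 = load I S M1" and "o2 = load I S M2"
  note defs = g1_def g2_def o1_def o2_def
  have inv: "o1 \<le> g2 \<or> o2 \<le> g2" "o1 \<le> g1 \<or> o2 \<le> s * g1"
    using greedy_invariant[OF s G I dom] by (simp_all add: defs)
  have nonneg: "0 \<le> g1" "0 \<le> g2" "0 \<le> o2"
    using I by (simp_all add: defs load_nonneg)
  have "g1 * 1 \<le> g1 * s" "o2 * 1 \<le> o2 * s" "g2 * 1 \<le> g2 * s"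
    using nonneg s by (intro mult_left_mono; simp)+
  then have "g1 \<le> s * g1" "o2 / s \<le> o2"
    using s by (simp_all add: field_simps)
  moreover have "o2 / s \<le> g1" if "o2 \<le> s * g1"
    using that s by (simp add: field_simps)
  \<comment> \<open>The target \<open>s * min g1 (g2 / s)\<close> is the smaller of
    \<open>s * g1\<close> and \<open>g2\<close>; each disjunction of the invariant gives one of the
    two bounds.\<close>
  ultimately have "min o1 (o2 / s) \<le> g2" "min o1 (o2 / s) \<le> s * g1"
    using inv by linarith+
  then have "min o1 (o2 / s) \<le> s * min g1 (g2 / s)"
    using s by (auto simp: min_def)
  then show ?thesis
    by (simp add: solution_value_load defs)
qed

lemma Opt_ge:
  assumes "valid_input I" "dominates_prefixes s A I S"
  shows "solution_value s I S \<le> solution_value s I (Opt s A I)"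
proof -
  \<comment> \<open>Optimality compares offline algorithms, so the single schedule \<open>S\<close>
    is completed to one by copying \<open>A\<close> on all other inputs.\<close>
  define B where "B J = (if J = I then S else run A J)" for J
  have "online_bounded s A B"
    using assms(2) by (simp add: online_bounded_iff B_def dominates_prefixes_run)
  then have "solution_value s I (B I) \<le> solution_value s I (Opt s A I)"
    using is_Opt_Opt[of s A] assms(1) by (simp add: is_Opt_def)
  then show ?thesis
    by (simp add: B_def)
qed

section \<open>Two-job inputs attaining the bound\<close>

lemma load_short:
  "load [a] [m1] m = (if m1 = m then a else 0)"
  "load [a, b] [m1, m2] m = (if m1 = m then a else 0) + (if m2 = m then b else 0)"
  using load_snoc[of "[]" "[]" a m1 m] load_snoc[of "[m1]" "[a]" b m2 m] by simp_all

lemma dominates_prefixes_two: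
  assumes "s > 0" "a > 0"
    and "solution_value s [a, b] (run A [a, b]) \<le> solution_value s [a, b] [m1, m2]"
  shows "dominates_prefixes s A [a, b] [m1, m2]"
proof -
  have "solution_value s [a] [m] = 0" for m
    using assms(1,2) by (cases m) (simp_all add: solution_value_load load_short)
  moreover have "solution_value s [] S = 0" for S
    by (simp add: solution_value_load)
  moreover have "run A [a] = [A [] a]"
    by (simp add: run_def)
  ultimately show ?thesis
    using assms(3) by (auto simp: dominates_prefixes_def le_Suc_eq)
qed

lemma greedy_tight:
  assumes s: "s \<ge> 1" and G: "greedy s G"
  obtains I S where "valid_input I" "dominates_prefixes s G I S"
    "0 < solution_value s I S" "solution_value s I S = s * solution_value s I (run G I)"
proof -
  have run: "run G [1, b] = [G [] 1, G [1] b]" for b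
    by (simp add: run_def upt_rec)
  have least: "completion_time s [1] [G [] 1] (G [1] b) \<le> completion_time s [1] [G [] 1] m"
    if "b > 0" for b m
  proof -
    have "run G [1] = [G [] 1]" by (simp add: run_def)
    then show ?thesis
      using G[unfolded greedy_def, rule_format, of "[1]" b m] that by (simp add: valid_input_def)
  qed
  have ss: "1 \<le> s * s"
    using s mult_mono[of 1 s 1 s] by simp
  \<comment> \<open>Tie-breaking affects only the first job: afterwards its machine has positive
    completion time and the other has 0.\<close>
  have other: "G [1] b \<noteq> G [] 1" if "b > 0" for b
    using least[OF that, of M1] least[OF that, of M2] s
    by (cases "G [1] b"; cases "G [] 1") (auto simp: completion_time_load load_short)
  show thesis
  proof (cases "G [] 1")
    case M1
    with other[of "1 / s"] s have "G [1] (1 / s) = M2"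
      by (cases "G [1] (1 / s)") auto
    \<comment> \<open>The second size makes the swapped schedule finish both machines
      simultaneously; \<open>ss\<close> shows that the faster machine determines the greedy
      value.\<close>
    then have val: "solution_value s [1, 1 / s] (run G [1, 1 / s]) = 1 / s / s"
      "solution_value s [1, 1 / s] [M2, M1] = 1 / s"
      using s ss by (simp_all add: run M1 solution_value_load load_short min_def field_simps)
    have "1 / s / s \<le> 1 / s"
      using s by (simp add: field_simps)
    then have "dominates_prefixes s G [1, 1 / s] [M2, M1]"
      using s by (intro dominates_prefixes_two) (simp_all add: val)
    with val s show thesis
      by (intro that[of "[1, 1 / s]" "[M2, M1]"]) (auto simp: valid_input_def)
  next
    case M2
    with other[of s] s have "G [1] s = M1"
      by (cases "G [1] s") auto
    then have val: "solution_value s [1, s] (run G [1, s]) = 1 / s"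
      "solution_value s [1, s] [M1, M2] = 1"
      using s ss by (simp_all add: run M2 solution_value_load load_short min_def field_simps)
    have "dominates_prefixes s G [1, s] [M1, M2]"
      using s by (intro dominates_prefixes_two) (simp_all add: val)
    with val s show thesis
      by (intro that[of "[1, s]" "[M1, M2]"]) (auto simp: valid_input_def)
  qed
qed

section \<open>The online bounded ratio as a supremum\<close>

theorem theorem8:
  fixes s :: real and G :: online_algorithm
  assumes "s \<ge> 1" and "greedy s G"
  shows "online_bounded_ratio s G = ereal (1 / s)"
  unfolding online_bounded_ratio_def
proof (rule Sup_eqI)
  fix y
  assume "y \<in> {ereal c | c. \<forall>I. valid_input I \<longrightarrow>
            c * solution_value s I (Opt s G I) \<le> solution_value s I (run G I)}"
  then obtain c where y: "y = ereal c"
    and c: "\<And>I. valid_input I \<Longrightarrow>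
              c * solution_value s I (Opt s G I) \<le> solution_value s I (run G I)"
    by blast
  obtain I S where I: "valid_input I" "dominates_prefixes s G I S"
    and S: "0 < solution_value s I S" "solution_value s I S = s * solution_value s I (run G I)"
    using greedy_tight[OF assms] .
  define v where "v = solution_value s I (Opt s G I)"
  have v: "solution_value s I S \<le> v"
    using Opt_ge[OF I] by (simp add: v_def)
  \<comment> \<open>On the tight input the greedy value is that of \<open>S\<close> divided by
    \<open>s\<close>, hence at most \<open>v / s\<close>; cancelling the positive \<open>v\<close>
    bounds \<open>c\<close>.\<close>
  have "c * v \<le> solution_value s I S / s"
    using c[OF I(1)] S(2) assms(1) by (simp add: v_def)
  also have "\<dots> \<le> 1 / s * v"
    using v assms(1) by (simp add: divide_right_mono)
  finally have "c \<le> 1 / s"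
    by (rule mult_right_le_imp_le) (use v S(1) in linarith)
  then show "y \<le> ereal (1 / s)"
    by (simp add: y)
next
  \<comment> \<open>The constant \<open>1 / s\<close> itself belongs to the set, so the supremum is
    attained.\<close>
  have "1 / s * solution_value s I (Opt s G I) \<le> solution_value s I (run G I)"
    if "valid_input I" for I
  proof -
    have "dominates_prefixes s G I (Opt s G I)"
      using is_Opt_Opt[of s G] that by (simp add: is_Opt_def online_bounded_iff)
    from greedy_lower_bound[OF assms that this] show ?thesis
      using assms(1) by (simp add: field_simps)
  qed
  then show "ereal (1 / s) \<le> y"
    if "\<And>z. z \<in> {ereal c | c. \<forall>I. valid_input I \<longrightarrow>
            c * solution_value s I (Opt s G I) \<le> solution_value s I (run G I)} \<Longrightarrow> z \<le> y" for y
    using that by blast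
qed

end
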